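(* Let $(X,d_X,\mu_X)$ and $(Y,d_Y,\mu_Y)$ be complete, separable, locally compact, path-connected metric measure spaces, each containing more than one point, with $\operatorname{supp}\mu_X=X$ and $\operatorname{supp}\mu_Y=Y$, and let $\varphi:X\to Y$ be a Lipschitz-isomorphism between them, i.e. $\varphi_*\mu_X=\mu_Y$ and there is a constant $C\in[1,\infty)$ with $$\tfrac1C d_X(x,y)\le d_Y(\varphi(x),\varphi(y))\le C\,d_X(x,y)\quad\text{for all }x,y\in X.$$ Suppose the Einstein relation with constant $c$ holds on $X$ with respect to an operator $(A,\mathscr D(A))$ on $L^2(X,\mu_X)$ satisfying the Standing Assumptions on operators. Then the Einstein relation with the same constant $c$ holds on $Y$ with respect to the operator $\varphi_{\mathbb L}A=(\varphi^* )^{-1}\circ A\circ\varphi^*$ on $L^2(Y,\mu_Y)$ with domain $(\varphi^* )^{-1}(\mathscr D(A))$, where $\varphi^*f=f\circ\varphi$.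
   Context: A metric measure space is a complete separable metric space with a Radon measure; if the space is compact, the measure is assumed to be a probability measure. $\varphi_*\mu_X$ is the pushforward measure. Since $\varphi$ is a bimeasurable bijection with $\varphi_*\mu_X=\mu_Y$, $\varphi^*:L^2(Y,\mu_Y)\to L^2(X,\mu_X)$, $f\mapsto f\circ\varphi$, is an isometric isomorphism. Standing Assumptions on an operator $A:L^2(X,\mu)\supseteq\mathscr D(A)\to L^2(X,\mu)$: (1) $A$ is densely defined and self-adjoint. (2) The spectrum of $A$ is nonempty, contained in $[0,\infty)$, and has a single accumulation point at $+\infty$, so that the eigenvalues can be enumerated with multiplicity as $0\le\lambda_1\le\lambda_2\le\dots$ with $\lambda_n\nearrow\infty$. (3) $\mathscr D(\sqrt A)\cap C_c(X)$ is dense in $C_c(X)$ with respect to the supremum norm and dense in $\mathscr D(\sqrt A)$ with respect to the graph norm $\|f\|_{L^2}+\|\sqrt Af\|_{L^2}$, where $C_c(X)$ is the space of compactly supported continuous functions. (4) $-A$ is dissipative: $\|(\lambda+A)f\|\ge\lambda\|f\|$ for all $f\in\mathscr D(A)$, $\lambda>0$. Hausdorff dimension: $\dim_{\mathcal H}$ is the usual Hausdorff dimension of a metric space. Spectral dimension: with $N_A(x):=\max\{n\in\mathbb N:\lambda_n\le x\}$, put $\dim_{\mathcal S}(X,A):=\lim_{x\to\infty}\frac{\log N_A(x)}{\log x}$ if the limit exists (no factor 2). Walk dimension: for a process $M$ on $X$ and $x\in X$, let $\tau(r)$ be the first exit time of $M$ from the open ball $B(x,r)$, and $\dim_{\mathcal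 W}(X,M;x):=\lim_{r\searrow0}\frac{\log \mathbf E_x[\tau(r)]}{\log r}$. If this is $\mu$-a.e. constant in $x$, its value is denoted $\dim_{\mathcal W}(X,M)$. Associated process: $M=((M_t)_{t\ge0},(\mathbf P_x)_x)$ is a Hunt process on $X$ (possibly with a cemetery state) associated to $A$ via the Dirichlet form $\mathcal E(f,g)=\langle\sqrt Af,\sqrt Ag\rangle$ (assumed to be a Dirichlet form), i.e. the semigroup $T_tf(x)=\mathbf E_x[f(M_t)]$ on $L^2(X,\mu)$ has infinitesimal generator $-A$. Such a process is unique up to its behaviour on a polar set. Einstein relation: the Einstein relation with constant $c$ holds on $X$ with respect to $A$ if $\dim_{\mathcal H}(X)=c\,\dim_{\mathcal S}(X,A)\,\dim_{\mathcal W}(X,M)$, where $M$ is a Hunt process associated to $A$ (in particular all the quantities involved exist). *)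

theory Defs
  imports "HOL-Probability.Probability"
begin

section \<open>Metric measure spaces\<close>

text \<open>The underlying complete separable metric space is a type of class \<open>polish_space\<close>.\<close>

definition radon_measure :: "'a::metric_space measure \<Rightarrow> bool" where
  "radon_measure \<mu> \<longleftrightarrow> sets \<mu> = sets borel \<and>
     (\<forall>x. \<exists>U. open U \<and> x \<in> U \<and> emeasure \<mu> U < \<infinity>) \<and>
     (\<forall>B\<in>sets borel. emeasure \<mu> B = (SUP K\<in>{K. compact K \<and> K \<subseteq> B}. emeasure \<mu> K))"

definition metric_measure_space :: "'a::polish_space measure \<Rightarrow> bool" where
  "metric_measure_space \<mu> \<longleftrightarrow> radon_measure \<mu> \<and> (compact (UNIV :: 'a set) \<longrightarrow> prob_space \<mu>)"

definition measure_support :: "'a::topological_space measure \<Rightarrow> 'a set" where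
  "measure_support \<mu> = {x. \<forall>U. open U \<and> x \<in> U \<longrightarrow> emeasure \<mu> U > 0}"

text \<open>Surjectivity is not required: it follows when the target measure has full support.\<close>

definition lipschitz_iso ::
  "('a::polish_space \<Rightarrow> 'b::polish_space) \<Rightarrow> 'a measure \<Rightarrow> 'b measure \<Rightarrow> bool" where
  "lipschitz_iso \<phi> \<mu> \<nu> \<longleftrightarrow> distr \<mu> borel \<phi> = \<nu> \<and>
     (\<exists>C\<ge>1. \<forall>x y. 1 / C * dist x y \<le> dist (\<phi> x) (\<phi> y) \<and> dist (\<phi> x) (\<phi> y) \<le> C * dist x y)"


section \<open>Hausdorff dimension\<close>

text \<open>The convention is $0^0 = 1$ for nonempty sets, so that the case \<open>s = 0\<close> is counting measure.
  The library's \<open>diameter\<close> is meaningful for bounded sets only, whence \<open>bounded\<close> below.\<close>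

definition hausdorff_gauge :: "real \<Rightarrow> 'a::metric_space set \<Rightarrow> ennreal" where
  "hausdorff_gauge s U =
     (if U = {} then 0 else if s = 0 then 1 else ennreal (diameter U powr s))"

definition hausdorff_premeasure :: "real \<Rightarrow> real \<Rightarrow> 'a::metric_space set \<Rightarrow> ennreal" where
  "hausdorff_premeasure s \<delta> A =
     (INF U\<in>{U :: nat \<Rightarrow> 'a set. A \<subseteq> (\<Union>i. U i) \<and> (\<forall>i. bounded (U i) \<and> diameter (U i) \<le> \<delta>)}.
        \<Sum>i. hausdorff_gauge s (U i))"

definition hausdorff_measure :: "real \<Rightarrow> 'a::metric_space set \<Rightarrow> ennreal" where
  "hausdorff_measure s A = (SUP \<delta>\<in>{0<..}. hausdorff_premeasure s \<delta> A)"

definition hausdorff_dim :: "'a::metric_space set \<Rightarrow> ereal" where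
  "hausdorff_dim A = Inf {ereal s | s. 0 \<le> s \<and> hausdorff_measure s A = 0}"


section \<open>Operators on $L^2$\<close>

text \<open>Elements of real $L^2(\mu)$ are handled through their measurable representatives; equality in
  $L^2$ is \<open>ae_eq\<close>, and operators are required to be compatible with it.\<close>

definition L2 :: "'a measure \<Rightarrow> ('a \<Rightarrow> real) set" where
  "L2 \<mu> = {f \<in> borel_measurable \<mu>. integrable \<mu> (\<lambda>x. (f x)\<^sup>2)}"

definition ae_eq :: "'a measure \<Rightarrow> ('a \<Rightarrow> real) \<Rightarrow> ('a \<Rightarrow> real) \<Rightarrow> bool" where
  "ae_eq \<mu> f g \<longleftrightarrow> (AE x in \<mu>. f x = g x)"

definition l2_inner :: "'a measure \<Rightarrow> ('a \<Rightarrow> real) \<Rightarrow> ('a \<Rightarrow> real) \<Rightarrow> real" where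
  "l2_inner \<mu> f g = (LINT x|\<mu>. f x * g x)"

definition l2_norm :: "'a measure \<Rightarrow> ('a \<Rightarrow> real) \<Rightarrow> real" where
  "l2_norm \<mu> f = sqrt (l2_inner \<mu> f f)"

record 'a l2_op =
  op_dom :: "('a \<Rightarrow> real) set"
  op_app :: "('a \<Rightarrow> real) \<Rightarrow> 'a \<Rightarrow> real"

definition l2_subspace :: "'a measure \<Rightarrow> ('a \<Rightarrow> real) set \<Rightarrow> bool" where
  "l2_subspace \<mu> D \<longleftrightarrow> D \<subseteq> L2 \<mu> \<and> (\<lambda>_. 0) \<in> D \<and>
     (\<forall>f\<in>D. \<forall>g\<in>D. \<forall>a b. (\<lambda>x. a * f x + b * g x) \<in> D) \<and>
     (\<forall>f\<in>D. \<forall>g\<in>L2 \<mu>. ae_eq \<mu> f g \<longrightarrow> g \<in> D)"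

definition l2_dense :: "'a measure \<Rightarrow> ('a \<Rightarrow> real) set \<Rightarrow> bool" where
  "l2_dense \<mu> D \<longleftrightarrow> (\<forall>f\<in>L2 \<mu>. \<forall>\<epsilon>>0. \<exists>g\<in>D. l2_norm \<mu> (\<lambda>x. f x - g x) < \<epsilon>)"

definition l2_operator :: "'a measure \<Rightarrow> 'a l2_op \<Rightarrow> bool" where
  "l2_operator \<mu> A \<longleftrightarrow> l2_subspace \<mu> (op_dom A) \<and>
     (\<forall>f\<in>op_dom A. op_app A f \<in> L2 \<mu>) \<and>
     (\<forall>f\<in>op_dom A. \<forall>g\<in>op_dom A. ae_eq \<mu> f g \<longrightarrow> ae_eq \<mu> (op_app A f) (op_app A g)) \<and>
     (\<forall>f\<in>op_dom A. \<forall>g\<in>op_dom A. \<forall>a b.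
        ae_eq \<mu> (op_app A (\<lambda>x. a * f x + b * g x)) (\<lambda>x. a * op_app A f x + b * op_app A g x))"

text \<open>For densely defined \<open>A\<close>, the left-hand side of the equivalence says that \<open>(g, h)\<close> lies in the
  graph of the adjoint of \<open>A\<close>, the right-hand side that it lies in the graph of \<open>A\<close>.\<close>

definition self_adjoint :: "'a measure \<Rightarrow> 'a l2_op \<Rightarrow> bool" where
  "self_adjoint \<mu> A \<longleftrightarrow> l2_operator \<mu> A \<and> l2_dense \<mu> (op_dom A) \<and>
     (\<forall>g\<in>L2 \<mu>. \<forall>h\<in>L2 \<mu>.
        (\<forall>f\<in>op_dom A. l2_inner \<mu> (op_app A f) g = l2_inner \<mu> f h) \<longleftrightarrow>
        (g \<in> op_dom A \<and> ae_eq \<mu> (op_app A g) h))"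

text \<open>\<open>s\<close> is in the resolvent set if \<open>A - s\<close> is a bijection from the domain of \<open>A\<close> onto $L^2$ with
  bounded inverse; the norm bound contains injectivity. Real scalars suffice, the spectrum of a
  self-adjoint operator being real.\<close>

definition resolvent_set :: "'a measure \<Rightarrow> 'a l2_op \<Rightarrow> real set" where
  "resolvent_set \<mu> A = {s.
     (\<forall>h\<in>L2 \<mu>. \<exists>f\<in>op_dom A. ae_eq \<mu> (\<lambda>x. op_app A f x - s * f x) h) \<and>
     (\<exists>K. \<forall>f\<in>op_dom A. l2_norm \<mu> f \<le> K * l2_norm \<mu> (\<lambda>x. op_app A f x - s * f x))}"

definition op_spectrum :: "'a measure \<Rightarrow> 'a l2_op \<Rightarrow> real set" where
  "op_spectrum \<mu> A = - resolvent_set \<mu> A"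

definition eigenspace :: "'a measure \<Rightarrow> 'a l2_op \<Rightarrow> real \<Rightarrow> ('a \<Rightarrow> real) set" where
  "eigenspace \<mu> A s = {f \<in> op_dom A. ae_eq \<mu> (op_app A f) (\<lambda>x. s * f x)}"

text \<open>\<open>E\<close> has a basis \<open>b 0, \<dots>, b (k - 1)\<close> as a subspace of $L^2$, that is, modulo equality
  almost everywhere.\<close>

definition has_l2_dim :: "'a measure \<Rightarrow> ('a \<Rightarrow> real) set \<Rightarrow> nat \<Rightarrow> bool" where
  "has_l2_dim \<mu> E k \<longleftrightarrow> (\<exists>b :: nat \<Rightarrow> 'a \<Rightarrow> real.
     (\<forall>i<k. b i \<in> E) \<and>
     (\<forall>c. ae_eq \<mu> (\<lambda>x. \<Sum>i<k. c i * b i x) (\<lambda>_. 0) \<longrightarrow> (\<forall>i<k. c i = 0)) \<and>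
     (\<forall>f\<in>E. \<exists>c. ae_eq \<mu> f (\<lambda>x. \<Sum>i<k. c i * b i x)))"

text \<open>\<open>l 1 \<le> l 2 \<le> \<dots>\<close> lists the eigenvalues with multiplicity; the value \<open>l 0\<close> is irrelevant.\<close>

definition eigenvalue_enumeration :: "'a measure \<Rightarrow> 'a l2_op \<Rightarrow> (nat \<Rightarrow> real) \<Rightarrow> bool" where
  "eigenvalue_enumeration \<mu> A l \<longleftrightarrow>
     (\<forall>n\<ge>1. l n \<le> l (Suc n)) \<and> filterlim l at_top sequentially \<and>
     (\<forall>s. has_l2_dim \<mu> (eigenspace \<mu> A s) (card {n. 1 \<le> n \<and> l n = s}))"

text \<open>The nonnegative self-adjoint square root of a nonnegative self-adjoint operator is unique up
  to equality almost everywhere, so \<open>is_sqrt\<close> determines it. Since operators act on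
  representatives, it is treated as a relation instead of a function.\<close>

definition is_sqrt :: "'a measure \<Rightarrow> 'a l2_op \<Rightarrow> 'a l2_op \<Rightarrow> bool" where
  "is_sqrt \<mu> A S \<longleftrightarrow> self_adjoint \<mu> S \<and>
     (\<forall>f\<in>op_dom S. 0 \<le> l2_inner \<mu> (op_app S f) f) \<and>
     op_dom A = {f \<in> op_dom S. op_app S f \<in> op_dom S} \<and>
     (\<forall>f\<in>op_dom A. ae_eq \<mu> (op_app A f) (op_app S (op_app S f)))"

definition Cc :: "('a::topological_space \<Rightarrow> real) set" where
  "Cc = {f. continuous_on UNIV f \<and> compact (closure {x. f x \<noteq> 0})}"

text \<open>The existence of \<open>l\<close> below includes that all multiplicities are finite.\<close>

definition standing_assumptions :: "'a::polish_space measure \<Rightarrow> 'a l2_op \<Rightarrow> bool" where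
  "standing_assumptions \<mu> A \<longleftrightarrow>
     self_adjoint \<mu> A \<and>
     (op_spectrum \<mu> A \<noteq> {} \<and> op_spectrum \<mu> A \<subseteq> {0..} \<and>
      (\<forall>s. \<not> s islimpt op_spectrum \<mu> A) \<and> \<not> bdd_above (op_spectrum \<mu> A) \<and>
      (\<exists>l. eigenvalue_enumeration \<mu> A l \<and> 0 \<le> l 1)) \<and>
     (\<exists>S. is_sqrt \<mu> A S \<and>
        (\<forall>f\<in>Cc. \<forall>\<epsilon>>0. \<exists>g\<in>op_dom S \<inter> Cc. \<forall>x. \<bar>f x - g x\<bar> < \<epsilon>) \<and>
        (\<forall>f\<in>op_dom S. \<forall>\<epsilon>>0. \<exists>g\<in>op_dom S \<inter> Cc.
           l2_norm \<mu> (\<lambda>x. f x - g x) + l2_norm \<mu> (op_app S (\<lambda>x. f x - g x)) < \<epsilon>)) \<and>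
     (\<forall>f\<in>op_dom A. \<forall>s>0. l2_norm \<mu> (\<lambda>x. s * f x + op_app A f x) \<ge> s * l2_norm \<mu> f)"

definition pullback :: "('a \<Rightarrow> 'b) \<Rightarrow> ('b \<Rightarrow> real) \<Rightarrow> 'a \<Rightarrow> real" where
  "pullback \<phi> f = f \<circ> \<phi>"

text \<open>For bijective \<open>\<phi>\<close>, the inverse of \<open>pullback \<phi>\<close> is \<open>pullback (inv \<phi>)\<close>.\<close>

definition push_operator :: "('a \<Rightarrow> 'b) \<Rightarrow> 'a l2_op \<Rightarrow> 'b l2_op" where
  "push_operator \<phi> A =
     \<lparr>op_dom = pullback (inv \<phi>) ` op_dom A,
      op_app = pullback (inv \<phi>) \<circ> op_app A \<circ> pullback \<phi>\<rparr>"


section \<open>Spectral dimension\<close>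

definition counting_function :: "(nat \<Rightarrow> real) \<Rightarrow> real \<Rightarrow> nat" where
  "counting_function l x = Max {n. 1 \<le> n \<and> l n \<le> x}"

definition has_spectral_dim :: "'a measure \<Rightarrow> 'a l2_op \<Rightarrow> real \<Rightarrow> bool" where
  "has_spectral_dim \<mu> A d \<longleftrightarrow> (\<exists>l. eigenvalue_enumeration \<mu> A l \<and>
     ((\<lambda>x. ln (real (counting_function l x)) / ln x) \<longlongrightarrow> d) at_top)"


section \<open>Dirichlet forms and semigroups\<close>

definition dirichlet_form ::
  "'a measure \<Rightarrow> ('a \<Rightarrow> real) set \<Rightarrow> (('a \<Rightarrow> real) \<Rightarrow> ('a \<Rightarrow> real) \<Rightarrow> real) \<Rightarrow> bool" where
  "dirichlet_form \<mu> D \<E> \<longleftrightarrow>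
     l2_subspace \<mu> D \<and> l2_dense \<mu> D \<and>
     (\<forall>f\<in>D. \<forall>f'\<in>D. \<forall>g\<in>D. ae_eq \<mu> f f' \<longrightarrow> \<E> f g = \<E> f' g) \<and>
     (\<forall>f\<in>D. \<forall>g\<in>D. \<forall>h\<in>D. \<forall>a b. \<E> (\<lambda>x. a * f x + b * g x) h = a * \<E> f h + b * \<E> g h) \<and>
     (\<forall>f\<in>D. \<forall>g\<in>D. \<E> f g = \<E> g f) \<and>
     (\<forall>f\<in>D. 0 \<le> \<E> f f) \<and>
     \<comment> \<open>closedness: \<open>D\<close> is complete for \<open>\<E>(f,f) + \<parallel>f\<parallel>\<^sup>2\<close>\<close>
     (let q = (\<lambda>f. \<E> f f + (l2_norm \<mu> f)\<^sup>2) in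
        \<forall>F. (\<forall>n. F n \<in> D) \<and>
            (\<forall>\<epsilon>>0. \<exists>N. \<forall>m\<ge>N. \<forall>n\<ge>N. q (\<lambda>x. F m x - F n x) < \<epsilon>) \<longrightarrow>
            (\<exists>f\<in>D. (\<lambda>n. q (\<lambda>x. F n x - f x)) \<longlonglongrightarrow> 0)) \<and>
     \<comment> \<open>the unit contraction operates\<close>
     (\<forall>f\<in>D. (\<lambda>x. min (max (f x) 0) 1) \<in> D \<and>
        \<E> (\<lambda>x. min (max (f x) 0) 1) (\<lambda>x. min (max (f x) 0) 1) \<le> \<E> f f)"

text \<open>Strongly continuous semigroup of bounded operators on $L^2$; only \<open>t \<ge> 0\<close> matters.\<close>

definition l2_semigroup :: "'a measure \<Rightarrow> (real \<Rightarrow> ('a \<Rightarrow> real) \<Rightarrow> 'a \<Rightarrow> real) \<Rightarrow> bool" where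
  "l2_semigroup \<mu> T \<longleftrightarrow>
     (\<forall>t\<ge>0. l2_operator \<mu> \<lparr>op_dom = L2 \<mu>, op_app = T t\<rparr> \<and>
            (\<exists>K. \<forall>f\<in>L2 \<mu>. l2_norm \<mu> (T t f) \<le> K * l2_norm \<mu> f)) \<and>
     (\<forall>f\<in>L2 \<mu>. ae_eq \<mu> (T 0 f) f) \<and>
     (\<forall>f\<in>L2 \<mu>. \<forall>s\<ge>0. \<forall>t\<ge>0. ae_eq \<mu> (T (s + t) f) (T s (T t f))) \<and>
     (\<forall>f\<in>L2 \<mu>. ((\<lambda>t. l2_norm \<mu> (\<lambda>x. T t f x - f x)) \<longlongrightarrow> 0) (at_right 0))"

definition infinitesimal_generator ::
  "'a measure \<Rightarrow> (real \<Rightarrow> ('a \<Rightarrow> real) \<Rightarrow> 'a \<Rightarrow> real) \<Rightarrow> 'a l2_op \<Rightarrow> bool" where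
  "infinitesimal_generator \<mu> T B \<longleftrightarrow>
     (\<forall>f\<in>L2 \<mu>. \<forall>g\<in>L2 \<mu>.
        ((\<lambda>t. l2_norm \<mu> (\<lambda>x. (T t f x - f x) / t - g x)) \<longlongrightarrow> 0) (at_right 0) \<longleftrightarrow>
        (f \<in> op_dom B \<and> ae_eq \<mu> (op_app B f) g))"

definition op_uminus :: "'a l2_op \<Rightarrow> 'a l2_op" where
  "op_uminus A = \<lparr>op_dom = op_dom A, op_app = (\<lambda>f x. - op_app A f x)\<rparr>"


section \<open>Hunt processes\<close>

text \<open>Time runs through $[0,\infty]$ (\<open>ennreal\<close>). The state space with cemetery is the type
  \<open>'a option\<close>, with \<open>None\<close> as the cemetery, topologised as the one-point compactification (\<open>None\<close> is
  isolated if \<open>'a\<close> is compact). The conditions follow Fukushima, Oshima and Takeda, Dirichlet Forms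
  and Symmetric Markov Processes, Appendix A.2.\<close>

record ('w, 'a) process =
  sample :: "'w measure"  \<comment> \<open>only its space and \<open>\<sigma>\<close>-algebra are used\<close>
  path :: "ennreal \<Rightarrow> 'w \<Rightarrow> 'a option"
  law :: "'a option \<Rightarrow> 'w measure"

abbreviation cemetery_top :: "'a::topological_space option topology" where
  "cemetery_top \<equiv> Alexandroff_compactification euclidean"

definition cemetery_borel :: "'a::topological_space option measure" where
  "cemetery_borel = sigma UNIV {U. openin cemetery_top U}"

definition initial_law :: "('w, 'a) process \<Rightarrow> 'a option measure \<Rightarrow> 'w measure" where
  "initial_law M \<nu> = measure_of (space (sample M)) (sets (sample M))
     (\<lambda>\<Lambda>. \<integral>\<^sup>+x. emeasure (law M x) \<Lambda> \<partial>\<nu>)"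

definition lifetime :: "('w, 'a) process \<Rightarrow> 'w \<Rightarrow> ennreal" where
  "lifetime M \<omega> = Inf {t. path M t \<omega> = None}"

text \<open>Normal Markov family. The universal measurability in the second line makes \<open>initial_law\<close> a
  measure on all of \<open>sets (sample M)\<close>. The Markov property itself is the case of constant times
  in \<open>strong_markov\<close>.\<close>

definition normal_laws :: "('w, 'a::metric_space) process \<Rightarrow> bool" where
  "normal_laws M \<longleftrightarrow>
     (\<forall>x. prob_space (law M x) \<and> space (law M x) = space (sample M) \<and> sets (law M x) = sets (sample M)) \<and>
     (\<forall>\<Lambda>\<in>sets (sample M). \<forall>\<nu>. prob_space \<nu> \<and> sets \<nu> = sets cemetery_borel \<longrightarrow>
        (\<lambda>x. emeasure (law M x) \<Lambda>) \<in> borel_measurable (completion \<nu>)) \<and>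
     (\<forall>t. path M t \<in> sample M \<rightarrow>\<^sub>M cemetery_borel) \<and>
     (\<forall>t. \<forall>B\<in>sets borel.
        (\<lambda>x. emeasure (law M (Some x)) {\<omega>\<in>space (sample M). path M t \<omega> \<in> Some ` B})
          \<in> borel_measurable borel) \<and>
     (\<forall>x. AE \<omega> in law M (Some x). path M 0 \<omega> = Some x) \<and>
     (\<forall>t. AE \<omega> in law M None. path M t \<omega> = None)"

definition hunt_paths :: "('w, 'a::metric_space) process \<Rightarrow> bool" where
  "hunt_paths M \<longleftrightarrow>
     (\<forall>\<omega>\<in>space (sample M).
        path M \<infinity> \<omega> = None \<and>
        (\<forall>t\<ge>lifetime M \<omega>. path M t \<omega> = None) \<and>
        (\<forall>t<\<infinity>. limitin cemetery_top (\<lambda>s. path M s \<omega>) (path M t \<omega>) (at_right t)) \<and>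
        (\<forall>t. 0 < t \<and> t < \<infinity> \<longrightarrow> (\<exists>l. limitin cemetery_top (\<lambda>s. path M s \<omega>) l (at_left t)))) \<and>
     (\<exists>\<theta> :: ennreal \<Rightarrow> 'w \<Rightarrow> 'w. \<forall>t. \<forall>\<omega>\<in>space (sample M).
        \<theta> t \<omega> \<in> space (sample M) \<and> (\<forall>s. path M s (\<theta> t \<omega>) = path M (s + t) \<omega>))"

definition admissible_filtration ::
  "('w, 'a::metric_space) process \<Rightarrow> (ennreal \<Rightarrow> 'w measure) \<Rightarrow> bool" where
  "admissible_filtration M F \<longleftrightarrow>
     filtration (space (sample M)) F \<and>
     (\<forall>t. sets (F t) \<subseteq> sets (sample M) \<and> path M t \<in> F t \<rightarrow>\<^sub>M cemetery_borel)"

definition right_continuous_filtration :: "(ennreal \<Rightarrow> 'w measure) \<Rightarrow> bool" where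
  "right_continuous_filtration F \<longleftrightarrow> (\<forall>t<\<infinity>. sets (F t) = (\<Inter>s\<in>{t<..}. sets (F s)))"

definition strong_markov ::
  "('w, 'a::metric_space) process \<Rightarrow> (ennreal \<Rightarrow> 'w measure) \<Rightarrow> bool" where
  "strong_markov M F \<longleftrightarrow>
     (\<forall>\<nu> \<sigma> s. \<forall>E\<in>sets cemetery_borel.
        prob_space \<nu> \<and> sets \<nu> = sets cemetery_borel \<and> stopping_time F \<sigma> \<longrightarrow>
        (AE \<omega> in initial_law M \<nu>.
           nn_cond_exp (initial_law M \<nu>) (filtration.pre_sigma (space (sample M)) F \<sigma>)
             (indicator {\<omega>'\<in>space (sample M). path M (\<sigma> \<omega>' + s) \<omega>' \<in> E}) \<omega>
           = emeasure (law M (path M (\<sigma> \<omega>) \<omega>)) {\<omega>'\<in>space (sample M). path M s \<omega>' \<in> E}))"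

definition quasi_left_continuous ::
  "('w, 'a::metric_space) process \<Rightarrow> (ennreal \<Rightarrow> 'w measure) \<Rightarrow> bool" where
  "quasi_left_continuous M F \<longleftrightarrow>
     (\<forall>\<nu> \<sigma> \<tau>. prob_space \<nu> \<and> sets \<nu> = sets cemetery_borel \<and>
        (\<forall>n::nat. stopping_time F (\<sigma> n)) \<and>
        (\<forall>\<omega>\<in>space (sample M). incseq (\<lambda>n. \<sigma> n \<omega>) \<and> \<tau> \<omega> = (SUP n. \<sigma> n \<omega>)) \<longrightarrow>
        (AE \<omega> in initial_law M \<nu>. \<tau> \<omega> < \<infinity> \<longrightarrow>
           limitin cemetery_top (\<lambda>n. path M (\<sigma> n \<omega>) \<omega>) (path M (\<tau> \<omega>) \<omega>) sequentially))"

definition hunt_process :: "('w, 'a::metric_space) process \<Rightarrow> bool" where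
  "hunt_process M \<longleftrightarrow> normal_laws M \<and> hunt_paths M \<and>
     (\<exists>F. admissible_filtration M F \<and> right_continuous_filtration F \<and>
          strong_markov M F \<and> quasi_left_continuous M F)"

text \<open>Functions are extended by \<open>0\<close> to the cemetery.\<close>

definition transition_semigroup ::
  "('w, 'a) process \<Rightarrow> real \<Rightarrow> ('a \<Rightarrow> real) \<Rightarrow> 'a \<Rightarrow> real" where
  "transition_semigroup M t f x =
     (\<integral>\<omega>. (case path M (ennreal t) \<omega> of None \<Rightarrow> 0 | Some y \<Rightarrow> f y) \<partial>law M (Some x))"

definition associated_process ::
  "'a::metric_space measure \<Rightarrow> 'a l2_op \<Rightarrow> ('w, 'a) process \<Rightarrow> bool" where
  "associated_process \<mu> A M \<longleftrightarrow>
     (\<exists>S. is_sqrt \<mu> A S \<and>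
        dirichlet_form \<mu> (op_dom S) (\<lambda>f g. l2_inner \<mu> (op_app S f) (op_app S g))) \<and>
     hunt_process M \<and>
     l2_semigroup \<mu> (transition_semigroup M) \<and>
     infinitesimal_generator \<mu> (transition_semigroup M) (op_uminus A)"


section \<open>Walk dimension and the Einstein relation\<close>

definition exit_time :: "('w, 'a) process \<Rightarrow> 'a set \<Rightarrow> 'w \<Rightarrow> ennreal" where
  "exit_time M U \<omega> = Inf {t. path M t \<omega> \<notin> Some ` U}"

definition ext_ln :: "ennreal \<Rightarrow> ereal" where
  "ext_ln x = (if x = 0 then -\<infinity> else if x = \<infinity> then \<infinity> else ereal (ln (enn2real x)))"

text \<open>The exit time is in general only measurable with respect to the completion of \<open>law M (Some x)\<close>,
  but \<open>nn_integral\<close> is insensitive to completion (\<open>nn_integral_completion\<close>).\<close>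

definition has_walk_dim_at :: "('w, 'a::metric_space) process \<Rightarrow> 'a \<Rightarrow> real \<Rightarrow> bool" where
  "has_walk_dim_at M x d \<longleftrightarrow>
     ((\<lambda>r. ext_ln (\<integral>\<^sup>+\<omega>. exit_time M (ball x r) \<omega> \<partial>law M (Some x)) / ereal (ln r))
        \<longlongrightarrow> ereal d) (at_right 0)"

definition has_walk_dim :: "'a::metric_space measure \<Rightarrow> ('w, 'a) process \<Rightarrow> real \<Rightarrow> bool" where
  "has_walk_dim \<mu> M d \<longleftrightarrow> (AE x in \<mu>. has_walk_dim_at M x d)"

text \<open>The type argument \<open>'w\<close> is the type of elementary events of the process \<open>M\<close>, over which HOL cannot
  quantify existentially.\<close>

definition einstein_relation ::
  "'w itself \<Rightarrow> 'a::polish_space measure \<Rightarrow> 'a l2_op \<Rightarrow> real \<Rightarrow> bool" where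
  "einstein_relation _ \<mu> A c \<longleftrightarrow>
     (\<exists>(M :: ('w, 'a) process) d_spec d_walk.
        associated_process \<mu> A M \<and> has_spectral_dim \<mu> A d_spec \<and> has_walk_dim \<mu> M d_walk \<and>
        hausdorff_dim (UNIV :: 'a set) = ereal (c * d_spec * d_walk))"

end

(* The mean exit times and the Hausdorff dimension are only compared, via the Lipschitz bounds.
   Everything else (spectrum, Dirichlet form, Hunt process) depends only on the measure and the
   topology, both of which phi transports: phi is onto because its range is closed and its
   complement is null for the fully supported measure on Y. The process on Y is the image of the
   process on X, with the same sample space and the laws reindexed by the inverse of phi. All
   these notions are parametric in a bijective relation between points, which is what makes the
   transport uniform. *)

theory Submission
  imports Defs
begin

unbundle lifting_syntax

section \<open>Measures related along a bijection\<close>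

lemma bi_total_graph: "bij f \<Longrightarrow> bi_total (\<lambda>x y. f x = y)"
  unfolding bi_total_def by (metis bij_pointE)

lemma bi_unique_graph: "bij f \<Longrightarrow> bi_unique (\<lambda>x y. f x = y)"
  unfolding bi_unique_def by (metis bij_pointE)

text \<open>The values are compared on all related sets, so that \<open>emeasure\<close> transfers
  as a total function. Non-measurable sets cause no conflict, since \<open>emeasure\<close> is
  \<open>0\<close> on them on both sides.\<close>

definition rel_measure :: "('a \<Rightarrow> 'b \<Rightarrow> bool) \<Rightarrow> 'a measure \<Rightarrow> 'b measure \<Rightarrow> bool" where
  "rel_measure R \<mu> \<nu> \<longleftrightarrow> rel_set R (space \<mu>) (space \<nu>) \<and>
     rel_set (rel_set R) (sets \<mu>) (sets \<nu>) \<and> (rel_set R ===> (=)) (emeasure \<mu>) (emeasure \<nu>)"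

lemma rel_measure_eq [relator_eq]: "rel_measure (=) = (=)"
  by (auto simp: rel_measure_def fun_eq_iff rel_set_eq rel_fun_eq intro: measure_eqI)

lemma space_transfer [transfer_rule]: "(rel_measure R ===> rel_set R) space space"
  by (auto simp: rel_measure_def rel_fun_def)

lemma sets_transfer [transfer_rule]: "(rel_measure R ===> rel_set (rel_set R)) sets sets"
  by (auto simp: rel_measure_def rel_fun_def)

lemma emeasure_transfer [transfer_rule]:
  "(rel_measure R ===> rel_set R ===> (=)) emeasure emeasure"
  by (auto simp: rel_measure_def rel_fun_def)

lemma sigma_algebra_transfer [transfer_rule]:
  assumes [transfer_rule]: "bi_total R" "bi_unique R"
  shows "(rel_set R ===> rel_set (rel_set R) ===> (=)) sigma_algebra sigma_algebra"
  unfolding sigma_algebra_iff2 by transfer_prover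

text \<open>\<open>sigma_sets\<close> is an inductive set; the intersection of all sigma-algebras
  containing the generator is an equivalent form built from parametric operations only.\<close>

lemma sigma_sets_UNIV_transfer:
  assumes [transfer_rule]: "bi_total R" "bi_unique R"
  shows "(rel_set (rel_set R) ===> rel_set (rel_set R)) (sigma_sets UNIV) (sigma_sets UNIV)"
proof -
  have *: "sigma_sets UNIV = (\<lambda>A :: 'c set set. \<Inter>{B. A \<subseteq> B \<and> sigma_algebra UNIV B})"
    by (intro ext sigma_sets_least_sigma_algebra) auto
  show ?thesis unfolding * by transfer_prover
qed

text \<open>Measurability of \<open>g\<close> makes images under \<open>f\<close> of measurable sets
  measurable, measurability of \<open>f\<close> gives the converse, and the image measure condition
  fixes the values.\<close>

lemma rel_measure_bijI:
  fixes f :: "'a \<Rightarrow> 'b"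
  assumes f: "f \<in> \<mu> \<rightarrow>\<^sub>M \<nu>" and g: "g \<in> \<nu> \<rightarrow>\<^sub>M \<mu>"
    and gf: "\<And>x. g (f x) = x" and fg: "\<And>y. f (g y) = y"
    and d: "distr \<mu> \<nu> f = \<nu>"
  shows "rel_measure (\<lambda>x y. f x = y) \<mu> \<nu>"
proof -
  have inj: "inj f" by (rule inj_on_inverseI) (rule gf)
  have rs: "rel_set (\<lambda>x y. f x = y) = (\<lambda>A B. B = f ` A)"
    by (intro ext) (auto simp: rel_set_def)
  have sp: "space \<nu> = f ` space \<mu>"
    using measurable_space[OF f] measurable_space[OF g] fg by (metis image_eqI image_subset_iff subsetI subset_antisym)
  have im: "f ` A = g -` A" for A
    by (rule set_eqI) (metis gf fg image_iff vimage_eq)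
  have A1: "f ` A \<in> sets \<nu>" if "A \<in> sets \<mu>" for A
  proof -
    have "f ` A = g -` A \<inter> space \<nu>"
      using that sets.sets_into_space[OF that] by (auto simp: sp im[symmetric])
    then show ?thesis using measurable_sets[OF g that] by simp
  qed
  have A2: "A \<in> sets \<mu>" if "f ` A \<in> sets \<nu>" for A
  proof -
    have "A \<subseteq> space \<mu>"
      using sets.sets_into_space[OF that] unfolding sp by (simp add: inj_image_subset_iff[OF inj])
    then have "A = f -` (f ` A) \<inter> space \<mu>"
      by (simp add: inj_vimage_image_eq[OF inj] Int_absorb2)
    then show ?thesis using measurable_sets[OF f that] by simp
  qed
  have em: "emeasure \<nu> (f ` A) = emeasure \<mu> A" for A
  proof (cases "A \<in> sets \<mu>")
    case True
    have "emeasure \<nu> (f ` A) = emeasure (distr \<mu> \<nu> f) (f ` A)" by (simp add: d)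
    also have "\<dots> = emeasure \<mu> (f -` (f ` A) \<inter> space \<mu>)"
      by (rule emeasure_distr[OF f A1[OF True]])
    also have "f -` (f ` A) \<inter> space \<mu> = A"
      using sets.sets_into_space[OF True] by (simp add: inj_vimage_image_eq[OF inj] Int_absorb2)
    finally show ?thesis .
  next
    case False
    \<comment> \<open>By \<open>A2\<close> the image of a non-measurable set is non-measurable, so
      both sides take the default value \<open>0\<close>.\<close>
    then show ?thesis using A2[of A] by (metis emeasure_notin_sets)
  qed
  have "\<exists>A\<in>sets \<mu>. B = f ` A" if "B \<in> sets \<nu>" for B
  proof -
    have "B = f ` (g ` B)" using fg by (simp add: image_image)
    then show ?thesis using A2[of "g ` B"] that by metis
  qed
  then have "rel_set (\<lambda>A B. B = f ` A) (sets \<mu>) (sets \<nu>)"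
    using A1 by (auto simp: rel_set_def)
  then show ?thesis
    by (simp add: rel_measure_def rel_fun_def rs sp em)
qed

text \<open>A measure is determined by its sigma-algebra and its values there, and \<open>R\<close>
  determines the partner of each set.\<close>

lemma bi_unique_rel_measure [transfer_rule]:
  assumes "bi_unique R"
  shows "bi_unique (rel_measure R)"
proof -
  have s: "bi_unique (rel_set (rel_set R))"
    by (intro bi_unique_rel_set assms)
  note S = sets_transfer[THEN rel_funD] and E = emeasure_transfer[THEN rel_funD, THEN rel_funD]
  have "\<mu> = \<mu>'" if h: "rel_measure R \<mu> \<nu>" "rel_measure R \<mu>' \<nu>" for \<mu> \<mu>' \<nu>
  proof (rule measure_eqI)
    show "sets \<mu> = sets \<mu>'"
      by (rule bi_uniqueDl[OF s S S]) (rule h)+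
    fix A assume "A \<in> sets \<mu>"
    then obtain B where B: "rel_set R A B" using rel_setD1[OF S[OF h(1)]] by blast
    show "emeasure \<mu> A = emeasure \<mu>' A"
      using E[OF h(1) B] E[OF h(2) B] by simp
  qed
  moreover have "\<nu> = \<nu>'" if h: "rel_measure R \<mu> \<nu>" "rel_measure R \<mu> \<nu>'" for \<mu> \<nu> \<nu>'
  proof (rule measure_eqI)
    show "sets \<nu> = sets \<nu>'"
      by (rule bi_uniqueDr[OF s S S]) (rule h)+
    fix B assume "B \<in> sets \<nu>"
    then obtain A where A: "rel_set R A B" using rel_setD2[OF S[OF h(1)]] by blast
    show "emeasure \<nu> B = emeasure \<nu>' B"
      using E[OF h(1) A] E[OF h(2) A] by simp
  qed
  ultimately show ?thesis unfolding bi_unique_def by blast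
qed

text \<open>The hypotheses make \<open>R\<close> the graph of a bijection \<open>f\<close> with
  inverse \<open>g\<close>, and the partner of \<open>\<mu>\<close> is its image under
  \<open>f\<close>.\<close>

lemma rel_measure_ex_right:
  assumes "bi_total R" "bi_unique R"
  shows "\<exists>\<nu>. rel_measure R \<mu> \<nu>"
proof -
  have "\<forall>x. \<exists>y. R x y" "\<forall>y. \<exists>x. R x y" using assms(1) unfolding bi_total_def by auto
  then obtain f g where f: "\<And>x. R x (f x)" and g: "\<And>y. R (g y) y" by metis
  have R: "R = (\<lambda>x y. f x = y)" and gf: "\<And>x. g (f x) = x" and fg: "\<And>y. f (g y) = y"
    using f g assms(2) unfolding bi_unique_def fun_eq_iff by metis+
  \<comment> \<open>Pulling the sigma-algebra back along \<open>g\<close> makes both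
    \<open>f\<close> and \<open>g\<close> measurable; only the sigma-algebra of \<open>N\<close>
    matters, the measure being supplied by \<open>distr\<close>.\<close>
  define N where "N = vimage_algebra (f ` space \<mu>) g \<mu>"
  have gm: "g \<in> f ` space \<mu> \<rightarrow> space \<mu>" using gf by auto
  have "f \<in> \<mu> \<rightarrow>\<^sub>M N"
    unfolding N_def by (rule measurable_vimage_algebra2) (auto simp: gf)
  moreover have "g \<in> N \<rightarrow>\<^sub>M \<mu>"
    unfolding N_def by (rule measurable_vimage_algebra1[OF gm])
  ultimately have "rel_measure R \<mu> (distr \<mu> N f)"
    unfolding R by (intro rel_measure_bijI[of f _ _ g]) (auto simp: gf fg distr_distr comp_def intro: distr_cong)
  then show ?thesis ..
qed

lemma rel_measure_conversep: "rel_measure R\<inverse>\<inverse> \<nu> \<mu> = rel_measure R \<mu> \<nu>"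
  by (auto simp: rel_measure_def rel_set_conversep rel_fun_def)

text \<open>This lets quantifiers over measures transfer, in particular those over initial
  distributions in the Hunt process conditions. The second half of totality is the first one for the
  converse relation.\<close>

lemma bi_total_rel_measure [transfer_rule]:
  assumes "bi_total R" "bi_unique R"
  shows "bi_total (rel_measure R)"
proof -
  have "\<exists>\<mu>. rel_measure R \<mu> \<nu>" for \<nu>
    using rel_measure_ex_right[of "R\<inverse>\<inverse>" \<nu>] assms
    by (simp add: rel_measure_conversep)
  then show ?thesis
    using rel_measure_ex_right[OF assms] unfolding bi_total_def by blast
qed

section \<open>Null sets, measurability, integrals and completions\<close>

lemma null_sets_transfer [transfer_rule]:
  assumes [transfer_rule]: "bi_total R" "bi_unique R"
  shows "(rel_measure R ===> rel_set (rel_set R)) null_sets null_sets"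
  unfolding null_sets_def by transfer_prover

lemma ae_filter_transfer [transfer_rule]:
  assumes [transfer_rule]: "bi_total R" "bi_unique R"
  shows "(rel_measure R ===> rel_filter R) ae_filter ae_filter"
  unfolding ae_filter_def by transfer_prover

lemma measurable_transfer [transfer_rule]:
  assumes [transfer_rule]: "bi_total R" "bi_unique R" "bi_total S" "bi_unique S"
  shows "(rel_measure R ===> rel_measure S ===> rel_set (R ===> S)) measurable measurable"
  unfolding measurable_def Pi_def by transfer_prover

lemma simple_function_transfer [transfer_rule]:
  assumes [transfer_rule]: "bi_total R" "bi_unique R"
  shows "(rel_measure R ===> (R ===> (=)) ===> (=)) simple_function simple_function"
  unfolding simple_function_def by transfer_prover

lemma simple_integral_transfer [transfer_rule]:
  assumes [transfer_rule]: "bi_total R" "bi_unique R"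
  shows "(rel_measure R ===> (R ===> (=)) ===> (=)) simple_integral simple_integral"
  unfolding simple_integral_def by transfer_prover

lemma nn_integral_transfer [transfer_rule]:
  assumes [transfer_rule]: "bi_total R" "bi_unique R"
  shows "(rel_measure R ===> (R ===> (=)) ===> (=)) nn_integral nn_integral"
  unfolding nn_integral_def le_fun_def by transfer_prover

lemma integrable_transfer [transfer_rule]:
  assumes [transfer_rule]: "bi_total R" "bi_unique R"
  shows "(rel_measure R ===> (R ===> (=)) ===> (=)) integrable
    (integrable :: _ \<Rightarrow> (_ \<Rightarrow> real) \<Rightarrow> _)"
  unfolding integrable_iff_bounded by transfer_prover

text \<open>A real integral is a difference of two nonnegative integrals for integrable functions
  and \<open>0\<close> by default otherwise. In this form it reduces to \<open>nn_integral\<close>,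
  bypassing the Bochner construction.\<close>

lemma lebesgue_integral_transfer [transfer_rule]:
  assumes [transfer_rule]: "bi_total R" "bi_unique R"
  shows "(rel_measure R ===> (R ===> (=)) ===> (=)) lebesgue_integral
    (lebesgue_integral :: _ \<Rightarrow> (_ \<Rightarrow> real) \<Rightarrow> _)"
proof -
  have *: "integral\<^sup>L = (\<lambda>M (f :: 'c \<Rightarrow> real). if integrable M f
      then enn2real (\<integral>\<^sup>+x. f x \<partial>M) - enn2real (\<integral>\<^sup>+x. ennreal (- f x) \<partial>M) else 0)"
    by (intro ext) (simp add: real_lebesgue_integral_def not_integrable_integral_eq)
  show ?thesis unfolding * by transfer_prover
qed

lemma prob_space_transfer [transfer_rule]:
  assumes [transfer_rule]: "bi_total R" "bi_unique R"
  shows "(rel_measure R ===> (=)) prob_space prob_space"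
proof -
  have *: "prob_space M \<longleftrightarrow> emeasure M (space M) = 1" for M :: "'c measure"
    by (metis prob_space.emeasure_space_1 prob_spaceI)
  show ?thesis unfolding * by transfer_prover
qed

text \<open>The completed measure is the outer measure restricted to completed sets, the infimum
  being attained at the cover from \<open>completion_upper\<close>. Unlike the definition of
  \<open>completion\<close>, which involves a chosen measurable part of each set, this formula is
  parametric.\<close>

lemma emeasure_completion_eq:
  "emeasure (completion M) A = (if A \<in> sets (completion M)
     then INF B\<in>{B\<in>sets M. A \<subseteq> B}. emeasure M B else 0)"
proof (cases "A \<in> sets (completion M)")
  case True
  from completion_upper[OF this] obtain A' where A': "A \<subseteq> A'" "A' \<in> sets M"
    "emeasure (completion M) A = emeasure M A'" by auto
  have "(INF B\<in>{B\<in>sets M. A \<subseteq> B}. emeasure M B) = emeasure (completion M) A"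
  proof (rule antisym)
    show "(INF B\<in>{B\<in>sets M. A \<subseteq> B}. emeasure M B) \<le> emeasure (completion M) A"
      unfolding A'(3) using A'(1,2) by (intro INF_lower) auto
    show "emeasure (completion M) A \<le> (INF B\<in>{B\<in>sets M. A \<subseteq> B}. emeasure M B)"
    proof (rule INF_greatest)
      fix B assume B: "B \<in> {B \<in> sets M. A \<subseteq> B}"
      then have "emeasure (completion M) A \<le> emeasure (completion M) B"
        by (intro emeasure_mono) auto
      then show "emeasure (completion M) A \<le> emeasure M B"
        using B by simp
    qed
  qed
  then show ?thesis
    using True by simp
next
  case False
  then show ?thesis
    by (simp add: emeasure_notin_sets)
qed

lemma completion_transfer [transfer_rule]:
  assumes [transfer_rule]: "bi_total R" "bi_unique R"
  shows "(rel_measure R ===> rel_measure R) completion completion"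
proof (rule rel_funI)
  fix M N assume [transfer_rule]: "rel_measure R M N"
  show "rel_measure R (completion M) (completion N)"
    unfolding rel_measure_def emeasure_completion_eq[abs_def] space_completion sets_completion
    by (intro conjI; transfer_prover)
qed

text \<open>\<open>sigma\<close> carries the zero measure, so only the generated sigma-algebras are
  to be compared. Both \<open>borel\<close> and \<open>cemetery_borel\<close> have this
  form.\<close>

lemma sigma_UNIV_transfer:
  assumes [transfer_rule]: "bi_total R" "bi_unique R"
  shows "(rel_set (rel_set R) ===> rel_measure R) (sigma UNIV) (sigma UNIV)"
proof -
  have *: "emeasure (sigma UNIV G) = (\<lambda>A. 0)" for G :: "'c set set"
    by (intro ext) (simp add: emeasure_sigma)
  have "rel_set R UNIV UNIV" by transfer_prover
  then show ?thesis
    using sigma_sets_UNIV_transfer[OF assms]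
    by (auto simp: rel_measure_def rel_fun_def * space_measure_of_conv)
qed

section \<open>Operators related along a bijection\<close>

lemma L2_transfer [transfer_rule]:
  assumes [transfer_rule]: "bi_total R" "bi_unique R"
  shows "(rel_measure R ===> rel_set (R ===> (=))) L2 L2"
  unfolding L2_def by transfer_prover

lemma ae_eq_transfer [transfer_rule]:
  assumes [transfer_rule]: "bi_total R" "bi_unique R"
  shows "(rel_measure R ===> (R ===> (=)) ===> (R ===> (=)) ===> (=)) ae_eq ae_eq"
  unfolding ae_eq_def by transfer_prover

lemma l2_inner_transfer [transfer_rule]:
  assumes [transfer_rule]: "bi_total R" "bi_unique R"
  shows "(rel_measure R ===> (R ===> (=)) ===> (R ===> (=)) ===> (=)) l2_inner l2_inner"
  unfolding l2_inner_def by transfer_prover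

lemma l2_norm_transfer [transfer_rule]:
  assumes [transfer_rule]: "bi_total R" "bi_unique R"
  shows "(rel_measure R ===> (R ===> (=)) ===> (=)) l2_norm l2_norm"
  unfolding l2_norm_def by transfer_prover

text \<open>Functions are related pointwise, not merely almost everywhere, and \<open>op_app\<close>
  is related also outside the domain; this is possible because \<open>push_operator\<close>
  conjugates \<open>op_app\<close> on all functions.\<close>

definition rel_l2_op :: "('a \<Rightarrow> 'b \<Rightarrow> bool) \<Rightarrow> 'a l2_op \<Rightarrow> 'b l2_op \<Rightarrow> bool" where
  "rel_l2_op R A B \<longleftrightarrow> rel_set (R ===> (=)) (op_dom A) (op_dom B) \<and>
     ((R ===> (=)) ===> R ===> (=)) (op_app A) (op_app B)"

lemma op_dom_transfer [transfer_rule]: "(rel_l2_op R ===> rel_set (R ===> (=))) op_dom op_dom"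
  by (auto simp: rel_l2_op_def rel_fun_def)

lemma op_app_transfer [transfer_rule]:
  "(rel_l2_op R ===> (R ===> (=)) ===> R ===> (=)) op_app op_app"
  by (auto simp: rel_l2_op_def rel_fun_def)

lemma l2_op_ext_transfer [transfer_rule]:
  "(rel_set (R ===> (=)) ===> ((R ===> (=)) ===> R ===> (=)) ===> (=) ===> rel_l2_op R)
     l2_op.l2_op_ext l2_op.l2_op_ext"
  by (auto simp: rel_l2_op_def rel_fun_def)

text \<open>Needed for the existential quantifier over the square root in
  \<open>associated_process\<close>.\<close>

lemma bi_total_rel_l2_op [transfer_rule]:
  assumes "bi_total R" "bi_unique R"
  shows "bi_total (rel_l2_op R)"
proof -
  have "bi_total (rel_set (R ===> ((=) :: real \<Rightarrow> _)))"
    "bi_total ((R ===> ((=) :: real \<Rightarrow> _)) ===> R ===> ((=) :: real \<Rightarrow> _))"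
    by (intro bi_total_rel_set bi_total_fun bi_unique_fun assms bi_total_eq bi_unique_eq)+
  then show ?thesis
    unfolding bi_total_def rel_l2_op_def by (metis l2_op.select_convs)
qed

lemma l2_subspace_transfer [transfer_rule]:
  assumes [transfer_rule]: "bi_total R" "bi_unique R"
  shows "(rel_measure R ===> rel_set (R ===> (=)) ===> (=)) l2_subspace l2_subspace"
  unfolding l2_subspace_def by transfer_prover

lemma l2_dense_transfer [transfer_rule]:
  assumes [transfer_rule]: "bi_total R" "bi_unique R"
  shows "(rel_measure R ===> rel_set (R ===> (=)) ===> (=)) l2_dense l2_dense"
  unfolding l2_dense_def by transfer_prover

lemma l2_operator_transfer [transfer_rule]:
  assumes [transfer_rule]: "bi_total R" "bi_unique R"
  shows "(rel_measure R ===> rel_l2_op R ===> (=)) l2_operator l2_operator"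
  unfolding l2_operator_def by transfer_prover

lemma self_adjoint_transfer [transfer_rule]:
  assumes [transfer_rule]: "bi_total R" "bi_unique R"
  shows "(rel_measure R ===> rel_l2_op R ===> (=)) self_adjoint self_adjoint"
  unfolding self_adjoint_def by transfer_prover

lemma eigenspace_transfer [transfer_rule]:
  assumes [transfer_rule]: "bi_total R" "bi_unique R"
  shows "(rel_measure R ===> rel_l2_op R ===> (=) ===> rel_set (R ===> (=))) eigenspace eigenspace"
  unfolding eigenspace_def by transfer_prover

lemma has_l2_dim_transfer [transfer_rule]:
  assumes [transfer_rule]: "bi_total R" "bi_unique R"
  shows "(rel_measure R ===> rel_set (R ===> (=)) ===> (=) ===> (=)) has_l2_dim has_l2_dim"
  unfolding has_l2_dim_def by transfer_prover

lemma eigenvalue_enumeration_transfer [transfer_rule]: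
  assumes [transfer_rule]: "bi_total R" "bi_unique R"
  shows "(rel_measure R ===> rel_l2_op R ===> (=) ===> (=))
    eigenvalue_enumeration eigenvalue_enumeration"
  unfolding eigenvalue_enumeration_def by transfer_prover

lemma has_spectral_dim_transfer [transfer_rule]:
  assumes [transfer_rule]: "bi_total R" "bi_unique R"
  shows "(rel_measure R ===> rel_l2_op R ===> (=) ===> (=)) has_spectral_dim has_spectral_dim"
  unfolding has_spectral_dim_def by transfer_prover

section \<open>Square roots, Dirichlet forms, semigroups and generators\<close>

lemma is_sqrt_transfer [transfer_rule]:
  assumes [transfer_rule]: "bi_total R" "bi_unique R"
  shows "(rel_measure R ===> rel_l2_op R ===> rel_l2_op R ===> (=)) is_sqrt is_sqrt"
  unfolding is_sqrt_def by transfer_prover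

lemma dirichlet_form_transfer [transfer_rule]:
  assumes [transfer_rule]: "bi_total R" "bi_unique R"
  shows "(rel_measure R ===> rel_set (R ===> (=)) ===> ((R ===> (=)) ===> (R ===> (=)) ===> (=)) ===> (=))
    dirichlet_form dirichlet_form"
  unfolding dirichlet_form_def by transfer_prover

lemma l2_semigroup_transfer [transfer_rule]:
  assumes [transfer_rule]: "bi_total R" "bi_unique R"
  shows "(rel_measure R ===> ((=) ===> (R ===> (=)) ===> R ===> (=)) ===> (=))
    l2_semigroup l2_semigroup"
  unfolding l2_semigroup_def by transfer_prover

lemma infinitesimal_generator_transfer [transfer_rule]:
  assumes [transfer_rule]: "bi_total R" "bi_unique R"
  shows "(rel_measure R ===> ((=) ===> (R ===> (=)) ===> R ===> (=)) ===> rel_l2_op R ===> (=))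
    infinitesimal_generator infinitesimal_generator"
  unfolding infinitesimal_generator_def by transfer_prover

lemma op_uminus_transfer [transfer_rule]: "(rel_l2_op R ===> rel_l2_op R) op_uminus op_uminus"
  unfolding op_uminus_def by transfer_prover

text \<open>Lifted to functions, the graph of \<open>f\<close> relates \<open>u\<close> to
  \<open>v\<close> exactly when \<open>u\<close> is the pullback of \<open>v\<close>. Conjugation by
  the pullback respects this by construction.\<close>

lemma rel_l2_op_push_operator:
  assumes "\<And>x. g (f x) = x" "\<And>y. f (g y) = y"
  shows "rel_l2_op (\<lambda>x y. f x = y) A (push_operator f A)"
proof -
  have "bij f" using assms by (metis bijI')
  then have inv: "inv f y = g y" for y
    using assms by (metis inv_f_f bij_is_inj)
  have *: "rel_fun (\<lambda>x y. f x = y) (=) = (\<lambda>u (v :: _ \<Rightarrow> real). u = v \<circ> f)"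
    by (auto simp: rel_fun_def fun_eq_iff)
  have "rel_set (\<lambda>u v. u = v \<circ> f) D ((\<lambda>u. u \<circ> inv f) ` D)" for D :: "(_ \<Rightarrow> real) set"
    by (auto simp: rel_set_def inv fun_eq_iff assms)
  moreover have push: "push_operator f A =
      \<lparr>op_dom = (\<lambda>u. u \<circ> inv f) ` op_dom A, op_app = (\<lambda>v. op_app A (v \<circ> f) \<circ> inv f)\<rparr>"
    by (auto simp: push_operator_def pullback_def[abs_def] fun_eq_iff)
  moreover have "((\<lambda>u v. u = v \<circ> f) ===> (\<lambda>u v. u = v \<circ> f)) T (\<lambda>v. T (v \<circ> f) \<circ> inv f)"
    for T :: "(_ \<Rightarrow> real) \<Rightarrow> _ \<Rightarrow> real"
    by (auto simp: rel_fun_def) (simp add: fun_eq_iff inv assms)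
  ultimately show ?thesis
    by (simp add: rel_l2_op_def * push)
qed

section \<open>Topologies related along a bijection\<close>

text \<open>Comparing open sets suffices, as the topological notions needed below all unfold to
  \<open>openin\<close>.\<close>

definition rel_topology :: "('a \<Rightarrow> 'b \<Rightarrow> bool) \<Rightarrow> 'a topology \<Rightarrow> 'b topology \<Rightarrow> bool" where
  "rel_topology R X Y \<longleftrightarrow> (rel_set R ===> (=)) (openin X) (openin Y)"

lemma openin_transfer [transfer_rule]: "(rel_topology R ===> rel_set R ===> (=)) openin openin"
  by (auto simp: rel_topology_def rel_fun_def)

lemma topspace_transfer [transfer_rule]:
  assumes [transfer_rule]: "bi_total R" "bi_unique R"
  shows "(rel_topology R ===> rel_set R) topspace topspace"
  unfolding topspace_def by transfer_prover

lemma closedin_transfer [transfer_rule]: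
  assumes [transfer_rule]: "bi_total R" "bi_unique R"
  shows "(rel_topology R ===> rel_set R ===> (=)) closedin closedin"
  unfolding closedin_def by transfer_prover

lemma compactin_transfer [transfer_rule]:
  assumes [transfer_rule]: "bi_total R" "bi_unique R"
  shows "(rel_topology R ===> rel_set R ===> (=)) compactin compactin"
  unfolding compactin_def by transfer_prover

lemma limitin_transfer [transfer_rule]:
  assumes [transfer_rule]: "bi_total R" "bi_unique R"
  shows "(rel_topology R ===> ((=) ===> R) ===> R ===> (=) ===> (=)) limitin limitin"
  unfolding limitin_def by transfer_prover

text \<open>The open sets of the compactification are described by open sets and complements of
  closed compact sets of the base space, hence parametrically; \<open>rel_option\<close> matches the
  two added points.\<close>

lemma Alexandroff_compactification_transfer [transfer_rule]:
  assumes [transfer_rule]: "bi_total R" "bi_unique R"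
  shows "(rel_topology R ===> rel_topology (rel_option R))
    Alexandroff_compactification Alexandroff_compactification"
proof (rule rel_funI)
  fix X :: "'a topology" and Y :: "'b topology"
  assume [transfer_rule]: "rel_topology R X Y"
  show "rel_topology (rel_option R) (Alexandroff_compactification X) (Alexandroff_compactification Y)"
    unfolding rel_topology_def openin_Alexandroff_compactification[abs_def] by transfer_prover
qed

text \<open>Of two related sets each is the preimage of the other under one of the continuous maps
  \<open>f\<close> and \<open>g\<close>.\<close>

lemma homeomorphism_rel_topology:
  assumes "continuous_on UNIV f" "continuous_on UNIV g"
    and "\<And>x. g (f x) = x" "\<And>y. f (g y) = y"
  shows "rel_topology (\<lambda>x y. f x = y) euclidean euclidean"
proof -
  have "open A \<longleftrightarrow> open B" if AB: "rel_set (\<lambda>x y. f x = y) A B" for A B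
  proof -
    have B: "B = f ` A"
      using AB by (auto simp: rel_set_def)
    have "A = f -` B"
      unfolding B by (rule inj_vimage_image_eq[symmetric]) (metis assms(3) injI)
    moreover have "B = g -` A"
      unfolding B by (rule set_eqI) (metis assms(3,4) image_iff vimage_eq)
    ultimately show ?thesis
      using assms(1,2) open_vimage by metis
  qed
  then show ?thesis
    by (auto simp: rel_topology_def rel_fun_def open_openin[symmetric])
qed

section \<open>Processes related along a homeomorphism\<close>

text \<open>Only the states are relabelled. As the sample space is shared, filtrations, stopping
  times and conditional expectations are the same objects on both sides.\<close>

definition rel_process :: "('a \<Rightarrow> 'b \<Rightarrow> bool) \<Rightarrow> ('w, 'a) process \<Rightarrow> ('w, 'b) process \<Rightarrow> bool" where
  "rel_process R M N \<longleftrightarrow> sample M = sample N \<and>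
     ((=) ===> (=) ===> rel_option R) (path M) (path N) \<and> (rel_option R ===> (=)) (law M) (law N)"

lemma sample_transfer [transfer_rule]: "(rel_process R ===> (=)) sample sample"
  by (auto simp: rel_process_def rel_fun_def)

lemma path_transfer [transfer_rule]: "(rel_process R ===> (=) ===> (=) ===> rel_option R) path path"
  by (auto simp: rel_process_def rel_fun_def)

lemma law_transfer [transfer_rule]: "(rel_process R ===> rel_option R ===> (=)) law law"
  by (auto simp: rel_process_def rel_fun_def)

lemma initial_law_transfer [transfer_rule]:
  assumes [transfer_rule]: "bi_total R" "bi_unique R"
  shows "(rel_process R ===> rel_measure (rel_option R) ===> (=)) initial_law initial_law"
  unfolding initial_law_def by transfer_prover

lemma lifetime_transfer [transfer_rule]:
  assumes [transfer_rule]: "bi_total R" "bi_unique R"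
  shows "(rel_process R ===> (=) ===> (=)) lifetime lifetime"
  unfolding lifetime_def by transfer_prover

lemma exit_time_transfer [transfer_rule]:
  assumes [transfer_rule]: "bi_total R" "bi_unique R"
  shows "(rel_process R ===> rel_set R ===> (=) ===> (=)) exit_time exit_time"
  unfolding exit_time_def by transfer_prover

lemma transition_semigroup_transfer [transfer_rule]:
  assumes [transfer_rule]: "bi_total R" "bi_unique R"
  shows "(rel_process R ===> (=) ===> (R ===> (=)) ===> R ===> (=))
    transition_semigroup transition_semigroup"
  unfolding transition_semigroup_def by transfer_prover

section \<open>Hunt process conditions and associated processes\<close>

context
  fixes R :: "'a::metric_space \<Rightarrow> 'b::metric_space \<Rightarrow> bool"
  assumes R [transfer_rule]: "bi_total R" "bi_unique R"
    and euclidean_transfer [transfer_rule]: "rel_topology R euclidean euclidean"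
begin

lemma cemetery_borel_transfer [transfer_rule]:
  "rel_measure (rel_option R) cemetery_borel cemetery_borel"
proof -
  have "rel_set (rel_set (rel_option R)) {U. openin cemetery_top U} {U. openin cemetery_top U}"
    by transfer_prover
  then show ?thesis
    unfolding cemetery_borel_def
    by (intro sigma_UNIV_transfer[THEN rel_funD] option.bi_total_rel option.bi_unique_rel R)
qed

lemma borel_transfer [transfer_rule]: "rel_measure R borel borel"
proof -
  have [transfer_rule]: "(rel_set R ===> (=)) open open"
    using euclidean_transfer by (auto simp: rel_topology_def rel_fun_def open_openin[symmetric])
  have "rel_set (rel_set R) {U. open U} {U. open U}"
    by transfer_prover
  then show ?thesis
    unfolding borel_def by (intro sigma_UNIV_transfer[THEN rel_funD] R)
qed

lemma normal_laws_transfer [transfer_rule]: "(rel_process R ===> (=)) normal_laws normal_laws"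
  unfolding normal_laws_def by transfer_prover

lemma hunt_paths_transfer [transfer_rule]: "(rel_process R ===> (=)) hunt_paths hunt_paths"
  unfolding hunt_paths_def by transfer_prover

lemma admissible_filtration_transfer [transfer_rule]:
  "(rel_process R ===> (=) ===> (=)) admissible_filtration admissible_filtration"
  unfolding admissible_filtration_def by transfer_prover

lemma strong_markov_transfer [transfer_rule]:
  "(rel_process R ===> (=) ===> (=)) strong_markov strong_markov"
  unfolding strong_markov_def by transfer_prover

lemma quasi_left_continuous_transfer [transfer_rule]:
  "(rel_process R ===> (=) ===> (=)) quasi_left_continuous quasi_left_continuous"
  unfolding quasi_left_continuous_def by transfer_prover

lemma hunt_process_transfer [transfer_rule]: "(rel_process R ===> (=)) hunt_process hunt_process"
  unfolding hunt_process_def by transfer_prover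

lemma associated_process_transfer [transfer_rule]:
  "(rel_measure R ===> rel_l2_op R ===> rel_process R ===> (=)) associated_process associated_process"
  unfolding associated_process_def by transfer_prover

end

lemma rel_process_push:
  assumes "\<And>x. g (f x) = x" "\<And>y. f (g y) = y"
  shows "rel_process (\<lambda>x y. f x = y) M
    \<lparr>sample = sample M, path = (\<lambda>t \<omega>. map_option f (path M t \<omega>)), law = law M \<circ> map_option g\<rparr>"
  using assms
  by (auto simp: rel_process_def rel_fun_def option.rel_map option_rel_Some1 elim!: option.rel_cases
      intro: option.rel_refl)

section \<open>Lipschitz and expanding maps, Hausdorff dimension\<close>

text \<open>The lower distance bound turns a convergent sequence of values into a Cauchy sequence of
  arguments, whose limit exists by completeness and is mapped to the limit of the values.\<close>

lemma closed_range_expanding: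
  fixes f :: "'a::complete_space \<Rightarrow> 'b::metric_space"
  assumes cont: "continuous_on UNIV f" and exp: "\<And>x y. dist x y \<le> C * dist (f x) (f y)"
  shows "closed (range f)"
  unfolding closed_sequential_limits
proof (intro allI impI, elim conjE)
  fix u l assume u: "\<forall>n. u n \<in> range f" and l: "u \<longlonglongrightarrow> l"
  then obtain v where v: "\<And>n. u n = f (v n)"
    unfolding image_iff by metis
  have "Cauchy v"
  proof (rule metric_CauchyI)
    fix e :: real assume "0 < e"
    \<comment> \<open>\<open>C\<close> has no sign condition here, so the positive bound
      \<open>\<bar>C\<bar> + 1\<close> replaces it.\<close>
    then have "0 < e / (\<bar>C\<bar> + 1)" by simp
    with LIMSEQ_imp_Cauchy[OF l] obtain K
      where K: "\<And>m n. m \<ge> K \<Longrightarrow> n \<ge> K \<Longrightarrow> dist (u m) (u n) < e / (\<bar>C\<bar> + 1)"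
      by (metis metric_CauchyD)
    have "dist (v m) (v n) < e" if "m \<ge> K" "n \<ge> K" for m n
    proof -
      have "dist (v m) (v n) \<le> C * dist (u m) (u n)"
        unfolding v by (rule exp)
      also have "\<dots> \<le> (\<bar>C\<bar> + 1) * dist (u m) (u n)"
        by (intro mult_right_mono) auto
      also have "\<dots> < e"
        using K[OF that] by (simp add: field_simps)
      finally show ?thesis .
    qed
    then show "\<exists>M. \<forall>m\<ge>M. \<forall>n\<ge>M. dist (v m) (v n) < e" by blast
  qed
  then obtain x where "v \<longlonglongrightarrow> x"
    using Cauchy_convergent convergent_def by blast
  then have "(\<lambda>n. f (v n)) \<longlonglongrightarrow> f x"
    using cont by (auto simp: continuous_on_eq_continuous_at intro: isCont_tendsto_compose)
  then have "l = f x"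
    using l LIMSEQ_unique unfolding v by blast
  then show "l \<in> range f" by blast
qed

section \<open>Hausdorff measure and dimension under Lipschitz maps\<close>

lemma bounded_lipschitz_image:
  fixes f :: "'a::metric_space \<Rightarrow> 'b::metric_space"
  assumes "\<And>x y. dist (f x) (f y) \<le> C * dist x y" "0 \<le> C" "bounded U"
  shows "bounded (f ` U)" and "diameter (f ` U) \<le> C * diameter U"
proof -
  have d: "dist (f x) (f y) \<le> C * diameter U" if "x \<in> U" "y \<in> U" for x y
    using assms(1)[of x y] mult_left_mono[OF diameter_bounded_bound[OF assms(3) that] assms(2)]
    by linarith
  then show "bounded (f ` U)"
    by (auto simp: bounded_two_points)
  show "diameter (f ` U) \<le> C * diameter U"
  proof (cases "U = {}")
    case False
    then show ?thesis
      unfolding diameter_def[of "f ` U"] using d by (auto intro!: cSUP_least)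
  qed simp
qed

text \<open>For \<open>s = 0\<close> the gauge of a nonempty set is \<open>1\<close> on both sides,
  consistent with \<open>C powr 0 = 1\<close>; otherwise the diameter bound is raised to the power
  \<open>s\<close>.\<close>

lemma hausdorff_gauge_lipschitz_image:
  fixes f :: "'a::metric_space \<Rightarrow> 'b::metric_space"
  assumes "\<And>x y. dist (f x) (f y) \<le> C * dist x y" "1 \<le> C" "0 \<le> s" "bounded U"
  shows "hausdorff_gauge s (f ` U) \<le> ennreal (C powr s) * hausdorff_gauge s U"
proof -
  have C: "0 \<le> C" using assms(2) by simp
  note im = bounded_lipschitz_image[OF assms(1) C assms(4)]
  have "diameter (f ` U) powr s \<le> C powr s * diameter U powr s"
    using powr_mono2[OF assms(3) diameter_ge_0[OF im(1)] im(2)] C diameter_ge_0[OF assms(4)]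
    by (simp add: powr_mult)
  then show ?thesis
    using assms(2) by (auto simp: hausdorff_gauge_def ennreal_mult[symmetric] intro!: ennreal_leI)
qed

lemma hausdorff_premeasure_lipschitz_image:
  fixes f :: "'a::metric_space \<Rightarrow> 'b::metric_space"
  assumes f: "\<And>x y. dist (f x) (f y) \<le> C * dist x y" and C: "1 \<le> C" and s: "0 \<le> s"
  shows "hausdorff_premeasure s (C * \<delta>) (f ` A) \<le> ennreal (C powr s) * hausdorff_premeasure s \<delta> A"
proof -
  have "hausdorff_premeasure s (C * \<delta>) (f ` A) \<le> ennreal (C powr s) * (\<Sum>i. hausdorff_gauge s (U i))"
    if U: "A \<subseteq> (\<Union>i. U i)" "\<And>i. bounded (U i)" "\<And>i. diameter (U i) \<le> \<delta>" for U :: "nat \<Rightarrow> 'a set"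
  proof -
    have C0: "0 \<le> C" using C by simp
    have "diameter (f ` U i) \<le> C * \<delta>" for i
      using bounded_lipschitz_image(2)[OF f C0 U(2)] mult_left_mono[OF U(3) C0] order_trans by blast
    moreover have "f ` A \<subseteq> (\<Union>i. f ` U i)"
      using U(1) by blast
    ultimately have "hausdorff_premeasure s (C * \<delta>) (f ` A) \<le> (\<Sum>i. hausdorff_gauge s (f ` U i))"
      unfolding hausdorff_premeasure_def using bounded_lipschitz_image(1)[OF f C0 U(2)]
      by (intro INF_lower) auto
    also have "\<dots> \<le> (\<Sum>i. ennreal (C powr s) * hausdorff_gauge s (U i))"
      by (intro suminf_le hausdorff_gauge_lipschitz_image f C s U) auto
    finally show ?thesis by simp
  qed
  \<comment> \<open>The factor is positive and finite, so it can be divided out before passing to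
    the infimum over covers and multiplied back afterwards.\<close>
  then have "hausdorff_premeasure s (C * \<delta>) (f ` A) / ennreal (C powr s) \<le> hausdorff_premeasure s \<delta> A"
    unfolding hausdorff_premeasure_def[of _ \<delta>] using C
    by (intro INF_greatest divide_le_posI_ennreal) (auto simp: mult.commute)
  then have "ennreal (C powr s) * (hausdorff_premeasure s (C * \<delta>) (f ` A) / ennreal (C powr s))
      \<le> ennreal (C powr s) * hausdorff_premeasure s \<delta> A"
    by (rule mult_left_mono) simp
  then show ?thesis
    using C by (simp add: ennreal_times_divide mult.commute[of "ennreal _"] ennreal_mult_divide_eq)
qed

lemma hausdorff_measure_lipschitz_image_eq_0:
  fixes f :: "'a::metric_space \<Rightarrow> 'b::metric_space"
  assumes f: "\<And>x y. dist (f x) (f y) \<le> C * dist x y" and C: "1 \<le> C" and s: "0 \<le> s"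
    and 0: "hausdorff_measure s A = 0"
  shows "hausdorff_measure s (f ` A) = 0"
proof -
  have "hausdorff_premeasure s \<delta> (f ` A) \<le> 0" if "0 < \<delta>" for \<delta>
  proof -
    \<comment> \<open>Covers of mesh \<open>\<delta> / C\<close> have images of mesh
      \<open>\<delta>\<close>.\<close>
    have "hausdorff_premeasure s (\<delta> / C) A \<le> hausdorff_measure s A"
      unfolding hausdorff_measure_def using that C by (intro SUP_upper) auto
    then show ?thesis
      using hausdorff_premeasure_lipschitz_image[OF f C s, of "\<delta> / C" A] C 0 by simp
  qed
  then have "hausdorff_measure s (f ` A) \<le> 0"
    unfolding hausdorff_measure_def by (intro SUP_least) auto
  then show ?thesis by simp
qed

text \<open>Every exponent with vanishing measure for \<open>A\<close> is also one for the image, so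
  the infimum for the image runs over a larger set.\<close>

lemma hausdorff_dim_lipschitz_image_le:
  fixes f :: "'a::metric_space \<Rightarrow> 'b::metric_space"
  assumes "\<And>x y. dist (f x) (f y) \<le> C * dist x y" "1 \<le> C"
  shows "hausdorff_dim (f ` A) \<le> hausdorff_dim A"
  unfolding hausdorff_dim_def
  using hausdorff_measure_lipschitz_image_eq_0[OF assms] by (intro Inf_superset_mono) blast

section \<open>Mean exit times and the walk dimension\<close>

lemma ext_ln_mono: "a \<le> b \<Longrightarrow> ext_ln a \<le> ext_ln b"
proof (cases b)
  case (real r)
  assume "a \<le> b"
  then obtain q where "a = ennreal q" "0 \<le> q" "q \<le> r"
    using real by (cases a) (auto simp: top_unique)
  then show ?thesis
    using real by (auto simp: ext_ln_def)
qed (simp add: ext_ln_def)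

text \<open>Divisors \<open>ln r\<close> are negative near \<open>0\<close>, which reverses
  inequalities; mean exit times \<open>0\<close> and \<open>\<infinity>\<close> make infinite
  numerators possible.\<close>

lemma ereal_divide_right_mono_neg:
  fixes a b :: ereal
  assumes "a \<le> b" "t < 0"
  shows "b / ereal t \<le> a / ereal t"
  using assms by (cases a; cases b) (auto simp: divide_right_mono_neg)

lemma filterlim_mult_at_right_0:
  fixes K :: real
  assumes "0 < K"
  shows "filterlim (\<lambda>r. K * r) (at_right 0) (at_right 0)"
proof -
  have "((\<lambda>r. K * r) \<longlongrightarrow> K * 0) (at_right 0)"
    by (intro tendsto_intros)
  then show ?thesis
    using assms by (auto simp: filterlim_at eventually_at_filter)
qed

text \<open>Rescaling \<open>r\<close> changes \<open>ln r\<close> by an additive constant only, which is negligible as \<open>r\<close> tends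
  to \<open>0\<close>.\<close>

lemma ext_ln_exponent_rescale:
  fixes E :: "real \<Rightarrow> ennreal"
  assumes E: "((\<lambda>r. ext_ln (E r) / ereal (ln r)) \<longlongrightarrow> ereal d) (at_right 0)" and K: "0 < K"
  shows "((\<lambda>r. ext_ln (E (K * r)) / ereal (ln r)) \<longlongrightarrow> ereal d) (at_right 0)"
proof -
  have inf: "filterlim (\<lambda>r::real. ln r) at_infinity (at_right 0)"
    using ln_at_0 at_bot_le_at_infinity filterlim_mono by blast
  \<comment> \<open>This is the correction factor \<open>ln (K * r) / ln r\<close>.\<close>
  have "((\<lambda>r. 1 + ln K / ln r) \<longlongrightarrow> 1 + 0) (at_right 0)"
    by (intro tendsto_add tendsto_const tendsto_divide_0[OF tendsto_const inf])
  then have one: "((\<lambda>r. ereal (1 + ln K / ln r)) \<longlongrightarrow> ereal 1) (at_right 0)"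
    by simp
  have "((\<lambda>r. ext_ln (E (K * r)) / ereal (ln (K * r)) * ereal (1 + ln K / ln r)) \<longlongrightarrow> ereal d * ereal 1) (at_right 0)"
    by (intro tendsto_mult_ereal one filterlim_compose[OF E filterlim_mult_at_right_0[OF K]]) auto
  moreover have "\<forall>\<^sub>F r in at_right 0. ext_ln (E (K * r)) / ereal (ln (K * r)) * ereal (1 + ln K / ln r)
      = ext_ln (E (K * r)) / ereal (ln r)"
  proof -
    have neg: "\<forall>\<^sub>F r::real in at_right 0. ln r < 0"
      using ln_at_0 by (simp add: filterlim_at_bot_dense)
    have "\<forall>\<^sub>F r in at_right 0. ln (K * r) < 0"
      using filterlim_compose[OF ln_at_0 filterlim_mult_at_right_0[OF K]]
      by (simp add: filterlim_at_bot_dense)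
    with neg eventually_at_right_less[of 0] show ?thesis
    proof eventually_elim
      case (elim r)
      \<comment> \<open>Both logarithms are negative, so the factor is positive and the cancellation
        is valid for infinite \<open>x\<close> as well.\<close>
      have "x / ereal (ln (K * r)) * ereal (1 + ln K / ln r) = x / ereal (ln r)" for x
      proof -
        have ln: "1 + ln K / ln r = ln (K * r) / ln r"
          using elim K by (simp add: ln_mult field_simps)
        then show ?thesis
          using elim unfolding ln by (cases x) (auto simp: divide_neg_neg zero_less_divide_iff)
      qed
      then show ?case .
    qed
  qed
  ultimately show ?thesis
    by (simp add: tendsto_cong)
qed

text \<open>Arbitrary sets are allowed because the preimage of a ball under a bi-Lipschitz map need
  not be a ball.\<close>

definition mean_exit_time :: "('w, 'a) process \<Rightarrow> 'a set \<Rightarrow> 'a \<Rightarrow> ennreal" where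
  "mean_exit_time M U x = (\<integral>\<^sup>+\<omega>. exit_time M U \<omega> \<partial>law M (Some x))"

lemma mean_exit_time_mono: "U \<subseteq> V \<Longrightarrow> mean_exit_time M U x \<le> mean_exit_time M V x"
  unfolding mean_exit_time_def exit_time_def
  by (intro nn_integral_mono Inf_superset_mono) auto

lemma mean_exit_time_transfer [transfer_rule]:
  assumes [transfer_rule]: "bi_total R" "bi_unique R"
  shows "(rel_process R ===> rel_set R ===> R ===> (=)) mean_exit_time mean_exit_time"
  unfolding mean_exit_time_def by transfer_prover

text \<open>The mean exit time of \<open>N\<close> from a ball equals that of \<open>M\<close> from
  the preimage of the ball, which lies between the balls of radii \<open>r / C\<close> and
  \<open>C * r\<close>. Rescaling the radius leaves the exponent unchanged.\<close>

lemma has_walk_dim_at_bilipschitz: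
  fixes f :: "'a::metric_space \<Rightarrow> 'b::metric_space"
  assumes MN: "rel_process (\<lambda>x y. f x = y) M N"
    and f: "bij f" and C: "1 \<le> C"
    and lower: "\<And>x y. dist x y \<le> C * dist (f x) (f y)"
    and upper: "\<And>x y. dist (f x) (f y) \<le> C * dist x y"
    and dim: "has_walk_dim_at M x d"
  shows "has_walk_dim_at N (f x) d"
proof -
  let ?R = "\<lambda>x y. f x = y"
  note R = bi_total_graph[OF f] bi_unique_graph[OF f]
  define E where "E r = mean_exit_time M (ball x r) x" for r
  define E' where "E' r = mean_exit_time N (ball (f x) r) (f x)" for r
  have E': "E' r = mean_exit_time M (f -` ball (f x) r) x" for r
  proof -
    have "rel_set ?R (f -` ball (f x) r) (ball (f x) r)"
    proof (rule rel_setI)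
      fix y assume "y \<in> ball (f x) r"
      moreover obtain z where "y = f z" using bij_is_surj[OF f] by (rule surjE)
      ultimately show "\<exists>z\<in>f -` ball (f x) r. f z = y" by auto
    qed auto
    from mean_exit_time_transfer[OF R, THEN rel_funD, THEN rel_funD, THEN rel_funD, OF MN this refl]
    show ?thesis
      unfolding E'_def by simp
  qed
  have E_lower: "E (1 / C * r) \<le> E' r" for r
    unfolding E_def E'
  proof (intro mean_exit_time_mono subsetI)
    fix z assume "z \<in> ball x (1 / C * r)"
    then have "C * dist x z < r" using C by (simp add: field_simps)
    then show "z \<in> f -` ball (f x) r" using upper[of x z] by simp
  qed
  have E_upper: "E' r \<le> E (C * r)" for r
    unfolding E_def E'
  proof (intro mean_exit_time_mono subsetI)
    fix z assume "z \<in> f -` ball (f x) r"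
    then have "C * dist (f x) (f z) < C * r" using C by simp
    then show "z \<in> ball x (C * r)" using lower[of x z] by simp
  qed
  have lim: "((\<lambda>r. ext_ln (E r) / ereal (ln r)) \<longlongrightarrow> ereal d) (at_right 0)"
    using dim unfolding has_walk_dim_at_def E_def mean_exit_time_def .
  have neg: "\<forall>\<^sub>F r::real in at_right 0. ln r < 0"
    using ln_at_0 by (simp add: filterlim_at_bot_dense)
  have "((\<lambda>r. ext_ln (E' r) / ereal (ln r)) \<longlongrightarrow> ereal d) (at_right 0)"
  \<comment> \<open>The larger ball gives the lower bound for the quotient, because
    \<open>ln r\<close> is negative.\<close>
  proof (rule tendsto_sandwich)
    show "\<forall>\<^sub>F r in at_right 0. ext_ln (E (C * r)) / ereal (ln r) \<le> ext_ln (E' r) / ereal (ln r)"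
      using neg by eventually_elim (intro ereal_divide_right_mono_neg ext_ln_mono E_upper)
    show "\<forall>\<^sub>F r in at_right 0. ext_ln (E' r) / ereal (ln r) \<le> ext_ln (E (1 / C * r)) / ereal (ln r)"
      using neg by eventually_elim (intro ereal_divide_right_mono_neg ext_ln_mono E_lower)
  qed (use C in \<open>intro ext_ln_exponent_rescale lim; simp\<close>)+
  then show ?thesis
    unfolding has_walk_dim_at_def E'_def mean_exit_time_def .
qed

theorem proposition3p4:
  fixes \<mu>X :: "'a::polish_space measure" and \<mu>Y :: "'b::polish_space measure"
    and \<phi> :: "'a \<Rightarrow> 'b" and A :: "'a l2_op" and c :: real
  assumes "metric_measure_space \<mu>X" and "metric_measure_space \<mu>Y"
    and "locally compact (UNIV :: 'a set)" and "locally compact (UNIV :: 'b set)"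
    and "path_connected (UNIV :: 'a set)" and "path_connected (UNIV :: 'b set)"
    and "\<exists>x y :: 'a. x \<noteq> y" and "\<exists>x y :: 'b. x \<noteq> y"
    and "measure_support \<mu>X = UNIV" and "measure_support \<mu>Y = UNIV"
    and "lipschitz_iso \<phi> \<mu>X \<mu>Y"
    and "standing_assumptions \<mu>X A"
    and "einstein_relation TYPE('w) \<mu>X A c"
  shows "einstein_relation TYPE('w) \<mu>Y (push_operator \<phi> A) c"
proof -
  let ?R = "\<lambda>x y. \<phi> x = y"
  have sets: "sets \<mu>X = sets borel" "sets \<mu>Y = sets borel"
    using assms(1,2) by (auto simp: metric_measure_space_def radon_measure_def)
  obtain C where distr: "distr \<mu>X borel \<phi> = \<mu>Y" and C: "1 \<le> C"
    and bilip: "\<And>x y. 1 / C * dist x y \<le> dist (\<phi> x) (\<phi> y)"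
    and upper: "\<And>x y. dist (\<phi> x) (\<phi> y) \<le> C * dist x y"
    using assms(11) unfolding lipschitz_iso_def by blast
  have lower: "dist x y \<le> C * dist (\<phi> x) (\<phi> y)" for x y
    using bilip[of x y] C by (simp add: field_simps)
  have cont: "continuous_on UNIV \<phi>"
    using C by (intro lipschitz_on_continuous_on[of C] lipschitz_onI upper) auto
  then have meas: "\<phi> \<in> \<mu>X \<rightarrow>\<^sub>M borel"
    using borel_measurable_continuous_onI measurable_cong_sets[OF sets(1) refl] by blast
  have bij: "bij \<phi>"
  proof (rule bijI)
    show "inj \<phi>"
      using lower by (intro injI) (metis dist_le_zero_iff dist_self mult_zero_right)
    then have "closed (range \<phi>)"
      using closed_range_expanding[OF cont lower] by blast
    then have op: "open (- range \<phi>)"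
      by (rule open_Compl)
    moreover have "emeasure \<mu>Y (- range \<phi>) = 0"
    proof -
      have "emeasure \<mu>Y (- range \<phi>) = emeasure \<mu>X (\<phi> -` (- range \<phi>) \<inter> space \<mu>X)"
        unfolding distr[symmetric] by (intro emeasure_distr meas borel_open op)
      also have "\<phi> -` (- range \<phi>) = {}"
        by auto
      finally show ?thesis by simp
    qed
    ultimately have "- range \<phi> = {}"
      using assms(10) unfolding measure_support_def by force
    then show "surj \<phi>" by auto
  qed
  define \<psi> where "\<psi> = inv \<phi>"
  have \<psi>: "\<psi> (\<phi> x) = x" "\<phi> (\<psi> y) = y" for x y
    using bij by (simp_all add: \<psi>_def bij_is_inj bij_is_surj surj_f_inv_f)
  have \<psi>_lip: "dist (\<psi> x) (\<psi> y) \<le> C * dist x y" for x y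
    using lower[of "\<psi> x" "\<psi> y"] by (simp add: \<psi>)
  have cont': "continuous_on UNIV \<psi>"
    using C by (intro lipschitz_on_continuous_on[of C] lipschitz_onI \<psi>_lip) auto
  have R: "bi_total ?R" "bi_unique ?R"
    using bij by (rule bi_total_graph, rule bi_unique_graph)
  have top: "rel_topology ?R euclidean euclidean"
    by (rule homeomorphism_rel_topology[OF cont cont' \<psi>])
  have \<mu>: "rel_measure ?R \<mu>X \<mu>Y"
  proof (rule rel_measure_bijI)
    show "\<phi> \<in> \<mu>X \<rightarrow>\<^sub>M \<mu>Y"
      using meas measurable_cong_sets[OF refl sets(2)] by blast
    show "\<psi> \<in> \<mu>Y \<rightarrow>\<^sub>M \<mu>X"
      using borel_measurable_continuous_onI[OF cont'] measurable_cong_sets[OF sets(2,1)] by blast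
    show "distr \<mu>X \<mu>Y \<phi> = \<mu>Y"
      using distr sets(2) by (metis distr_cong)
  qed (fact \<psi>)+
  have A: "rel_l2_op ?R A (push_operator \<phi> A)"
    by (rule rel_l2_op_push_operator[OF \<psi>])
  obtain M :: "('w, 'a) process" and ds dw where M: "associated_process \<mu>X A M"
    "has_spectral_dim \<mu>X A ds" "has_walk_dim \<mu>X M dw"
    "hausdorff_dim (UNIV :: 'a set) = ereal (c * ds * dw)"
    using assms(13) unfolding einstein_relation_def by blast
  \<comment> \<open>The image process keeps the sample space, hence also the type \<open>'w\<close>
    fixed in the conclusion.\<close>
  obtain N :: "('w, 'b) process" where N: "rel_process ?R M N"
    using rel_process_push[OF \<psi>] by blast
  have "associated_process \<mu>Y (push_operator \<phi> A) N"
    using associated_process_transfer[OF R top, THEN rel_funD, THEN rel_funD, THEN rel_funD, OF \<mu> A N] M(1)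
    by simp
  moreover have "has_spectral_dim \<mu>Y (push_operator \<phi> A) ds"
    using has_spectral_dim_transfer[OF R, THEN rel_funD, THEN rel_funD, THEN rel_funD, OF \<mu> A refl] M(2)
    by simp
  moreover have "has_walk_dim \<mu>Y N dw"
  proof -
    \<comment> \<open>The dimension passes from each point to its image; parametricity of
      \<open>eventually\<close> then carries the almost-everywhere quantifier from
      \<open>\<mu>X\<close> to \<open>\<mu>Y\<close>.\<close>
    have "AE x in \<mu>X. has_walk_dim_at N (\<phi> x) dw"
      using M(3) has_walk_dim_at_bilipschitz[OF N bij C lower upper]
      unfolding has_walk_dim_def by (auto elim: eventually_mono)
    moreover have "rel_fun ?R (=) (\<lambda>x. has_walk_dim_at N (\<phi> x) dw) (\<lambda>y. has_walk_dim_at N y dw)"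
      by (auto simp: rel_fun_def)
    note eventually_parametric[THEN rel_funD, THEN rel_funD, OF this ae_filter_transfer[OF R, THEN rel_funD, OF \<mu>]]
    ultimately show ?thesis
      unfolding has_walk_dim_def by simp
  qed
  moreover have "hausdorff_dim (UNIV :: 'b set) = hausdorff_dim (UNIV :: 'a set)"
  proof -
    have "range \<phi> = UNIV" "range \<psi> = UNIV"
      using \<psi> by (metis surjI)+
    then show ?thesis
      using hausdorff_dim_lipschitz_image_le[OF upper C, of UNIV]
        hausdorff_dim_lipschitz_image_le[OF \<psi>_lip C, of UNIV] by auto
  qed
  ultimately show ?thesis
    unfolding einstein_relation_def using M(4) by metis
qed

end
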